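(* Let $\mathcal{A} = \langle Q, \Sigma, \rightarrow, Q_0, \varphi\rangle$ be an automaton, let $T$ be a trap set of $\mathcal{A}$, and let $\rho$ be a run of $\mathcal{A}$ such that $\rho_i\in T$ for some $i\ge 0$. Then: (i) $\rho\models \mathrm{Inf}(S)$ for every $S\subseteq Q$ with $S\supseteq T$; (ii) if $T$ is a minimal trap set, then $\rho\models\mathrm{Inf}(S)$ for every non-empty $S\subseteq Q$ such that $S\cap T\neq\emptyset$ and $T\setminus S$ is a transient of $\mathcal{A}$.
   Context: An automaton is a tuple $\mathcal{A} = \langle Q, \Sigma, \rightarrow, Q_0, \varphi\rangle$ where $Q$ is a finite set of states, $\Sigma$ a finite alphabet, $\rightarrow \subseteq Q\times\Sigma\times Q$ a labelled transition relation, $Q_0\subseteq Q$ a non-empty set of initial states, and $\varphi$ an acceptance condition. We write $q \xrightarrow{a} q'$ iff $(q,a,q')\in\rightarrow$, and $q\rightarrow q'$ iff $q\xrightarrow{a}q'$ for some $a$. A run of $\mathcal{A}$ for a word $w=w_0w_1\dots\in\Sigma^\omega$ is an infinite sequence of states $\rho=\rho_0\rho_1\dots$ with $\rho_0\in Q_0$ and $\rho_i\xrightarrow{w_i}\rho_{i+1}$ for all $i$. For a non-empty $S\subseteq Q$: $\rho\models\mathrm{Fin}(S)$ iff there is $i$ such that $\rho_j\notin S$ for all $j>i$ ($S$ is visited only finitely often); $\rho\models\mathrm{Inf}(S)$ iff $\rho\not\models\mathrm{Fin}(S)$. A non-empty set $T\subseteq Q$ is a trap set if for every $q\in T$, $q\rightarrow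 q'$ implies $q'\in T$; it is minimal if no proper subset of it is a trap set. A set $S\subseteq Q$ is a transient of $\mathcal{A}$ if every run of $\mathcal{A}$ models $\mathrm{Inf}(Q\setminus S)$. *)

theory Defs
  imports "HOL-Library.Omega_Words_Fun"
begin

text \<open>The acceptance condition has its own type parameter: neither runs nor trap sets nor
  transients depend on it, so it may be of any kind.\<close>

record ('q, 'a, 'c) automaton =
  states :: "'q set"
  alphabet :: "'a set"
  transitions :: "('q \<times> 'a \<times> 'q) set"
  initial :: "'q set"
  acceptance :: 'c

definition is_automaton :: "('q, 'a, 'c) automaton \<Rightarrow> bool" where
  "is_automaton A \<longleftrightarrow>
     finite (states A) \<and> finite (alphabet A) \<and>
     transitions A \<subseteq> states A \<times> alphabet A \<times> states A \<and>
     initial A \<subseteq> states A \<and> initial A \<noteq> {}"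

definition step :: "('q, 'a, 'c) automaton \<Rightarrow> 'q \<Rightarrow> 'q \<Rightarrow> bool" where
  "step A q q' \<longleftrightarrow> (\<exists>a. (q, a, q') \<in> transitions A)"

definition run_for :: "('q, 'a, 'c) automaton \<Rightarrow> 'a word \<Rightarrow> 'q word \<Rightarrow> bool" where
  "run_for A w \<rho> \<longleftrightarrow>
     range w \<subseteq> alphabet A \<and> \<rho> 0 \<in> initial A \<and>
     (\<forall>i. (\<rho> i, w i, \<rho> (Suc i)) \<in> transitions A)"

definition is_run :: "('q, 'a, 'c) automaton \<Rightarrow> 'q word \<Rightarrow> bool" where
  "is_run A \<rho> \<longleftrightarrow> (\<exists>w. run_for A w \<rho>)"

text \<open>The literature restricts these to non-empty sets. Here they are total; every run satisfies
  \<open>models_Fin\<close> of the empty set, so the full state set is a transient only if there is no run.\<close>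

definition models_Fin :: "'q word \<Rightarrow> 'q set \<Rightarrow> bool" where
  "models_Fin \<rho> S \<longleftrightarrow> (\<exists>i. \<forall>j>i. \<rho> j \<notin> S)"

definition models_Inf :: "'q word \<Rightarrow> 'q set \<Rightarrow> bool" where
  "models_Inf \<rho> S \<longleftrightarrow> \<not> models_Fin \<rho> S"

definition trap_set :: "('q, 'a, 'c) automaton \<Rightarrow> 'q set \<Rightarrow> bool" where
  "trap_set A T \<longleftrightarrow>
     T \<noteq> {} \<and> T \<subseteq> states A \<and> (\<forall>q\<in>T. \<forall>q'. step A q q' \<longrightarrow> q' \<in> T)"

definition minimal_trap_set :: "('q, 'a, 'c) automaton \<Rightarrow> 'q set \<Rightarrow> bool" where
  "minimal_trap_set A T \<longleftrightarrow> trap_set A T \<and> (\<forall>T'. T' \<subset> T \<longrightarrow> \<not> trap_set A T')"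

definition transient :: "('q, 'a, 'c) automaton \<Rightarrow> 'q set \<Rightarrow> bool" where
  "transient A S \<longleftrightarrow>
     S \<subseteq> states A \<and> (\<forall>\<rho>. is_run A \<rho> \<longrightarrow> models_Inf \<rho> (states A - S))"

end

theory Submission
  imports Defs
begin

text \<open>A run cannot leave a trap set (\<open>run_stays_in_trap_set\<close>), so from some index
  i on all its states lie in \<open>T\<close>. Being visited infinitely often depends only on the
  tail of the run, so a set \<open>R\<close> visited infinitely often may be replaced by any
  \<open>S\<close> that contains \<open>R \<inter> T\<close>
  (\<open>models_Inf_eventually_mono\<close>). Both parts are instances of this: \<open>R\<close> is
  the full state set in (i) and the complement of the transient \<open>T - S\<close> in
  (ii).\<close>

lemma models_Inf_iff: "models_Inf \<rho> S \<longleftrightarrow> (\<forall>i. \<exists>j>i. \<rho> j \<in> S)"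
  by (simp add: models_Inf_def models_Fin_def)

lemma run_in_states:
  assumes "is_automaton A" "is_run A \<rho>"
  shows "\<rho> i \<in> states A"
  using assms by (fastforce simp: is_run_def run_for_def is_automaton_def)

lemma run_step:
  assumes "is_run A \<rho>"
  shows "step A (\<rho> i) (\<rho> (Suc i))"
  using assms by (auto simp: is_run_def run_for_def step_def)

lemma run_stays_in_trap_set:
  assumes "trap_set A T" "is_run A \<rho>" "\<rho> i \<in> T" "i \<le> j"
  shows "\<rho> j \<in> T"
  using assms(4)
proof (induction j rule: dec_induct)
  case base
  show ?case by (fact assms(3))
next
  case (step n)
  then show ?case
    using assms(1) run_step[OF assms(2), of n] by (auto simp: trap_set_def)
qed

text \<open>Finitely many visits do not matter for Inf, so the inclusion of \<open>R\<close> in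
  \<open>S\<close> has to hold only along the run and only from index \<open>i\<close> on.\<close>

lemma models_Inf_eventually_mono:
  assumes "models_Inf \<rho> R" "\<And>j. j \<ge> i \<Longrightarrow> \<rho> j \<in> R \<Longrightarrow> \<rho> j \<in> S"
  shows "models_Inf \<rho> S"
  unfolding models_Inf_iff
proof
  fix k
  obtain j where "j > max i k" "\<rho> j \<in> R"
    using assms(1) unfolding models_Inf_iff by blast
  then show "\<exists>j>k. \<rho> j \<in> S"
    using assms(2)[of j] by auto
qed

theorem theorem1:
  fixes A :: "('q, 'a, 'c) automaton" and T :: "'q set" and \<rho> :: "'q word"
  assumes "is_automaton A"
    and "trap_set A T"
    and "is_run A \<rho>"
    and "\<exists>i. \<rho> i \<in> T"
  shows "(\<forall>S. S \<subseteq> states A \<and> T \<subseteq> S \<longrightarrow> models_Inf \<rho> S) \<and>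
         (minimal_trap_set A T \<longrightarrow>
           (\<forall>S. S \<subseteq> states A \<and> S \<noteq> {} \<and> S \<inter> T \<noteq> {} \<and> transient A (T - S)
              \<longrightarrow> models_Inf \<rho> S))"
proof -
  obtain i where "\<rho> i \<in> T" using assms(4) by blast
  then have T: "\<rho> j \<in> T" if "j \<ge> i" for j
    using run_stays_in_trap_set[OF assms(2,3)] that by blast
  \<comment> \<open>The run is in \<open>states A\<close> at every index; from \<open>i\<close> on
    this means in \<open>T\<close>, hence in any superset of \<open>T\<close>.\<close>
  have "models_Inf \<rho> (states A)"
    using run_in_states[OF assms(1,3)] by (auto simp: models_Inf_iff)
  then have "models_Inf \<rho> S" if "T \<subseteq> S" for S
    by (rule models_Inf_eventually_mono[where i = i]) (use T that in blast)
  \<comment> \<open>A state in \<open>T\<close> but outside \<open>T - S\<close> lies in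
    \<open>S\<close>, so after \<open>i\<close> each visit to the complement of the transient is a
    visit to \<open>S\<close>.\<close>
  moreover have "models_Inf \<rho> S" if "transient A (T - S)" for S
  proof (rule models_Inf_eventually_mono[where i = i])
    show "models_Inf \<rho> (states A - (T - S))"
      using that assms(3) by (simp add: transient_def)
  qed (use T in blast)
  ultimately show ?thesis by blast
qed

end
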